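(* For every integer $n\ge 2$ we have $\mathrm{QEC}(P_n)<\mathrm{QEC}(P_{n+1})$.
   Context: $P_n$ is the path on $n$ vertices $\{1,2,\dots,n\}$, where $i$ and $j$ are adjacent if and only if $|i-j|=1$. For a finite connected graph $G=(V,E)$ with $|V|\ge2$, $d(i,j)$ denotes the length of a shortest walk connecting $i$ and $j$ (with $d(i,i)=0$), and $D=[d(i,j)]_{i,j\in V}$ is the distance matrix. $C(V)$ is the space of real-valued functions on $V$, $\langle\cdot,\cdot\rangle$ its canonical inner product, and $\mathbf 1$ the constant function with value $1$. The quadratic embedding constant of $G$ is $$\mathrm{QEC}(G)=\max\{\langle f,Df\rangle : f\in C(V),\ \langle f,f\rangle=1,\ \langle \mathbf 1,f\rangle=0\}.$$ *)

theory Defs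
  imports Complex_Main "Graph_Theory.Graph_Theory"
begin

text \<open>Undirected graphs are symmetric digraphs (locale \<^locale>\<open>graph\<close>): each edge is
  represented by its two orientations.\<close>

definition path_graph :: "nat \<Rightarrow> (nat, nat \<times> nat) pre_digraph" where
  "path_graph n = \<lparr>verts = {1..n},
     arcs = {(i, j). i \<in> {1..n} \<and> j \<in> {1..n} \<and> \<bar>int i - int j\<bar> = 1},
     tail = fst, head = snd\<rparr>"

text \<open>The length of a shortest walk; only meaningful if \<open>v\<close> is reachable from \<open>u\<close>.\<close>

definition graph_dist :: "('a, 'b) pre_digraph \<Rightarrow> 'a \<Rightarrow> 'a \<Rightarrow> nat" where
  "graph_dist G u v = (LEAST k. \<exists>p. pre_digraph.awalk G u p v \<and> length p = k)"

text \<open>Real functions on a vertex set \<open>V\<close> are represented by total functions; all the operations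
  below read only their values on \<open>V\<close>.\<close>

definition inner_on :: "'a set \<Rightarrow> ('a \<Rightarrow> real) \<Rightarrow> ('a \<Rightarrow> real) \<Rightarrow> real" where
  "inner_on V f g = (\<Sum>v\<in>V. f v * g v)"

definition dist_matrix_apply :: "('a, 'b) pre_digraph \<Rightarrow> ('a \<Rightarrow> real) \<Rightarrow> 'a \<Rightarrow> real" where
  "dist_matrix_apply G f i = (\<Sum>j\<in>verts G. real (graph_dist G i j) * f j)"

text \<open>The maximum is taken over an infinite set of reals, so it is rendered by \<open>GREATEST\<close>
  (\<^const>\<open>Max\<close> is for finite sets). It is attained for finite connected graphs with at least
  two vertices, and only these are relevant.\<close>

definition QEC :: "('a, 'b) pre_digraph \<Rightarrow> real" where
  "QEC G = (GREATEST x. x \<in> {inner_on (verts G) f (dist_matrix_apply G f) | f.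
     inner_on (verts G) f f = 1 \<and> inner_on (verts G) (\<lambda>_. 1) f = 0})"

lemma graph_path_graph: "graph (path_graph n)"
proof
  show "finite (arcs (path_graph n))"
    by (rule finite_subset[of _ "{1..n} \<times> {1..n}"]) (auto simp: path_graph_def)
  show "symmetric (path_graph n)"
    by (auto simp: path_graph_def symmetric_def sym_def arcs_ends_conv image_iff)
qed (auto simp: path_graph_def arc_to_ends_def)

lemma reachable_path_graph:
  assumes "i \<in> {1..n}" "j \<in> {1..n}" "i \<le> j"
  shows "i \<rightarrow>\<^sup>*\<^bsub>path_graph n\<^esub> j"
  using assms(3,1,2)
proof (induction rule: dec_induct)
  case base
  then show ?case
    by (simp add: reachable_def path_graph_def)
next
  case (step k)
  interpret graph "path_graph n" by (rule graph_path_graph)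
  have "(k, Suc k) \<in> arcs_ends (path_graph n)"
    using step by (auto simp: path_graph_def arcs_ends_conv image_iff)
  moreover have "i \<rightarrow>\<^sup>*\<^bsub>path_graph n\<^esub> k"
    using step by simp
  ultimately show ?case
    by (meson reachable_adj_trans)
qed

lemma connected_path_graph:
  assumes "n \<ge> 1"
  shows "connected (path_graph n)"
proof -
  interpret graph "path_graph n" by (rule graph_path_graph)
  have "i \<rightarrow>\<^sup>*\<^bsub>path_graph n\<^esub> j" if "i \<in> {1..n}" "j \<in> {1..n}" for i j
    using that reachable_path_graph symmetric_reachable[OF sym_arcs] by (cases "i \<le> j") auto
  moreover have "verts (path_graph n) = {1..n}"
    by (simp add: path_graph_def)
  ultimately show ?thesis
    using assms sym_arcs unfolding connected_def
    by (intro strongly_connectedI) (auto simp: reachable_mk_symmetric_eq)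
qed

end

theory Submission
  imports Defs
begin

text \<open>The idea is to compute the constant exactly: \<open>QEC (P\<^sub>n) = - 1 / (1 + cos (\<pi> / n))\<close>, which
  increases strictly with \<open>n\<close> because the cosine decreases on \<open>[0, \<pi>]\<close>.

  The computation passes from \<open>f\<close> to its partial sums \<open>S\<^sub>k = f\<^sub>1 + \<dots> + f\<^sub>k\<close>. If \<open>f\<close> has mean zero,
  then \<open>S\<^sub>0 = S\<^sub>n = 0\<close>, the distance form \<open>\<Sum> \<bar>i - j\<bar> f\<^sub>i f\<^sub>j\<close> becomes \<open>- 2 \<Sum> S\<^sub>k\<^sup>2\<close>
  (\<open>distance_form_partial_sums\<close>), and the normalisation \<open>\<Sum> f\<^sub>i\<^sup>2\<close> becomes the discrete Dirichlet
  energy \<open>\<Sum> (S\<^sub>k\<^sub>+\<^sub>1 - S\<^sub>k)\<^sup>2\<close>. So the constant is \<open>- 2\<close> divided by the largest Dirichlet eigenvalue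
  \<open>2 + 2 cos (\<pi> / n)\<close> of the discrete Laplacian, whose eigenvector is \<open>S\<^sub>k = (-1)\<^sup>k sin (k \<pi> / n)\<close>.
  That this value bounds the energy is \<open>dirichlet_energy_upper_bound\<close>, and that it is attained is
  \<open>dirichlet_energy_alternating_sine\<close>. Having an explicit maximiser also shows directly that the
  maximum in the definition exists, without a compactness argument.\<close>

section \<open>Distances in the path graph\<close>

text \<open>Each arc changes the label by one, so a walk is at least as long as the difference of the
  labels of its ends.\<close>

lemma path_graph_cas_length:
  assumes "pre_digraph.cas (path_graph n) u p v" "set p \<subseteq> arcs (path_graph n)"
  shows "\<bar>int u - int v\<bar> \<le> int (length p)"
  using assms
proof (induction p arbitrary: u)
  case Nil
  then show ?case by (simp add: pre_digraph.cas.simps)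
next
  case (Cons e p)
  obtain a b where e: "e = (a, b)" by (cases e)
  from Cons.prems have "u = a" "\<bar>int a - int b\<bar> = 1" "pre_digraph.cas (path_graph n) b p v"
    by (auto simp: e pre_digraph.cas.simps path_graph_def)
  with Cons.IH[of b] Cons.prems(2) show ?case by auto
qed

lemma path_graph_ascending_walk:
  assumes "i \<le> j" "1 \<le> i" "j \<le> n"
  shows "\<exists>p. pre_digraph.awalk (path_graph n) i p j \<and> length p = j - i"
  using assms(1,2)
proof (induction rule: inc_induct)
  case base
  with assms show ?case
    by (intro exI[of _ "[]"])
      (auto simp: pre_digraph.awalk_def pre_digraph.cas.simps path_graph_def)
next
  case (step k)
  then obtain p where p: "pre_digraph.awalk (path_graph n) (Suc k) p j" "length p = j - Suc k"
    by auto
  with step assms show ?case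
    by (intro exI[of _ "(k, Suc k) # p"])
      (auto simp: pre_digraph.awalk_def pre_digraph.cas.simps path_graph_def)
qed

lemma path_graph_descending_walk:
  assumes "j \<le> i" "1 \<le> j" "i \<le> n"
  shows "\<exists>p. pre_digraph.awalk (path_graph n) i p j \<and> length p = i - j"
  using assms(1,3)
proof (induction rule: dec_induct)
  case base
  with assms show ?case
    by (intro exI[of _ "[]"])
      (auto simp: pre_digraph.awalk_def pre_digraph.cas.simps path_graph_def)
next
  case (step k)
  then obtain p where p: "pre_digraph.awalk (path_graph n) k p j" "length p = k - j"
    by auto
  with step assms show ?case
    by (intro exI[of _ "(Suc k, k) # p"])
      (auto simp: pre_digraph.awalk_def pre_digraph.cas.simps path_graph_def)
qed

lemma graph_dist_path_graph:
  assumes "i \<in> {1..n}" "j \<in> {1..n}"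
  shows "real (graph_dist (path_graph n) i j) = \<bar>real i - real j\<bar>"
proof -
  let ?d = "nat \<bar>int i - int j\<bar>"
  have "graph_dist (path_graph n) i j = ?d"
    unfolding graph_dist_def
  proof (rule Least_equality)
    show "\<exists>p. pre_digraph.awalk (path_graph n) i p j \<and> length p = ?d"
    proof (cases "i \<le> j")
      case True
      then have "?d = j - i" by simp
      with path_graph_ascending_walk[of i j n] True assms show ?thesis by simp
    next
      case False
      then have "?d = i - j" by simp
      with path_graph_descending_walk[of j i n] False assms show ?thesis by simp
    qed
  next
    fix k assume "\<exists>p. pre_digraph.awalk (path_graph n) i p j \<and> length p = k"
    then show "?d \<le> k"
      using path_graph_cas_length[of n i _ j] by (force simp: pre_digraph.awalk_def)
  qed
  then show ?thesis by (simp add: of_nat_nat)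
qed

section \<open>The distance form in terms of partial sums\<close>

lemma sum_of_partial_sums:
  fixes f :: "nat \<Rightarrow> real"
  shows "(\<Sum>i=1..n. (real (Suc n) - real i) * f i) = (\<Sum>k<Suc n. \<Sum>i=1..k. f i)"
proof (induction n)
  case (Suc n)
  have "(\<Sum>i=1..Suc n. (real (Suc (Suc n)) - real i) * f i)
      = (\<Sum>i=1..Suc n. (real (Suc n) - real i) * f i) + (\<Sum>i=1..Suc n. f i)"
    by (subst sum.distrib[symmetric]) (rule sum.cong, auto simp: algebra_simps)
  also have "(\<Sum>i=1..Suc n. (real (Suc n) - real i) * f i)
      = (\<Sum>i=1..n. (real (Suc n) - real i) * f i)"
    by simp
  finally show ?case
    using Suc by simp
qed simp

text \<open>For \<open>0 \<le> k < n\<close>, cutting the path after vertex \<open>k\<close> contributes the product of the masses on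
  the two sides, once for each orientation, and \<open>\<bar>i - j\<bar>\<close> counts the cuts that separate \<open>i\<close> from
  \<open>j\<close>. The induction adds the last vertex, whose distances to the others are summed by
  \<open>sum_of_partial_sums\<close>.\<close>

lemma distance_form_partial_sums:
  fixes f :: "nat \<Rightarrow> real"
  shows "(\<Sum>i=1..n. \<Sum>j=1..n. \<bar>real i - real j\<bar> * f i * f j)
    = 2 * (\<Sum>k<n. (\<Sum>i=1..k. f i) * ((\<Sum>i=1..n. f i) - (\<Sum>i=1..k. f i)))"
proof (induction n)
  case (Suc n)
  let ?S = "\<lambda>k. \<Sum>i=1..k. f i" and ?x = "f (Suc n)"
  have row: "(\<Sum>i=1..n. \<bar>real i - real (Suc n)\<bar> * f i * ?x) = ?x * (\<Sum>k<Suc n. ?S k)"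
    unfolding sum_of_partial_sums[symmetric] sum_distrib_left
    by (rule sum.cong) auto
  then have col: "(\<Sum>j=1..n. \<bar>real (Suc n) - real j\<bar> * ?x * f j) = ?x * (\<Sum>k<Suc n. ?S k)"
    by (simp only: abs_minus_commute mult.assoc mult.commute mult.left_commute)
  have "(\<Sum>i=1..Suc n. \<Sum>j=1..Suc n. \<bar>real i - real j\<bar> * f i * f j)
      = (\<Sum>i=1..n. \<Sum>j=1..n. \<bar>real i - real j\<bar> * f i * f j)
        + (\<Sum>i=1..n. \<bar>real i - real (Suc n)\<bar> * f i * ?x)
        + (\<Sum>j=1..n. \<bar>real (Suc n) - real j\<bar> * ?x * f j)"
    by (simp add: sum.distrib del: of_nat_Suc)
  also have "\<dots> = 2 * (\<Sum>k<n. ?S k * (?S n - ?S k)) + 2 * (?x * (\<Sum>k<Suc n. ?S k))"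
    unfolding Suc row col by simp
  also have "\<dots> = 2 * (\<Sum>k<Suc n. ?S k * (?S n - ?S k) + ?x * ?S k)"
    by (simp only: sum.distrib sum_distrib_left[of ?x ?S "{..<Suc n}"] distrib_left)
      (simp add: algebra_simps)
  also have "\<dots> = 2 * (\<Sum>k<Suc n. ?S k * (?S (Suc n) - ?S k))"
    by (simp add: algebra_simps)
  finally show ?case .
qed simp

lemma path_graph_distance_form:
  assumes "(\<Sum>i=1..n. f i) = 0"
  shows "inner_on (verts (path_graph n)) f (dist_matrix_apply (path_graph n) f)
    = - 2 * (\<Sum>k<n. (\<Sum>i=1..k. f i)\<^sup>2)"
proof -
  have "inner_on (verts (path_graph n)) f (dist_matrix_apply (path_graph n) f)
      = (\<Sum>i=1..n. \<Sum>j=1..n. real (graph_dist (path_graph n) i j) * f i * f j)"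
    by (simp add: inner_on_def dist_matrix_apply_def path_graph_def sum_distrib_left mult_ac)
  also have "\<dots> = (\<Sum>i=1..n. \<Sum>j=1..n. \<bar>real i - real j\<bar> * f i * f j)"
    by (intro sum.cong refl) (simp only: graph_dist_path_graph)
  finally show ?thesis
    unfolding distance_form_partial_sums assms by (simp add: power2_eq_square sum_negf)
qed

lemma inner_on_path_graph_partial_sums:
  "inner_on (verts (path_graph n)) f f = (\<Sum>k<n. ((\<Sum>i=1..Suc k. f i) - (\<Sum>i=1..k. f i))\<^sup>2)"
proof -
  have "(\<Sum>i=1..n. f i * f i) = (\<Sum>k<n. f (Suc k) * f (Suc k))"
    by (induction n) simp_all
  then show ?thesis
    by (simp add: inner_on_def path_graph_def power2_eq_square)
qed

section \<open>The largest Dirichlet eigenvalue of the discrete Laplacian\<close>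

lemma sin_three_term:
  fixes t :: real
  shows "sin (real m * t) + sin (real (Suc (Suc m)) * t) = 2 * cos t * sin (real (Suc m) * t)"
proof -
  have "real m * t = real (Suc m) * t - t" "real (Suc (Suc m)) * t = real (Suc m) * t + t"
    by (simp_all add: algebra_simps)
  then show ?thesis by (simp only: sin_add sin_diff) simp
qed

lemma minus_two_mult_le_weighted_squares:
  fixes x y r :: real
  assumes "r > 0"
  shows "- 2 * x * y \<le> r * x\<^sup>2 + y\<^sup>2 / r"
proof -
  have "0 \<le> (r * x + y)\<^sup>2 / r" using assms by simp
  also have "\<dots> = r * x\<^sup>2 + y\<^sup>2 / r + 2 * x * y"
    using assms by (simp add: field_simps power2_eq_square)
  finally show ?thesis by simp
qed

text \<open>This is a discrete Picone argument. In each cross term \<open>- 2 S\<^sub>k S\<^sub>k\<^sub>+\<^sub>1\<close> the weighted inequality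
  above is applied with \<open>r = s\<^sub>k\<^sub>+\<^sub>1 / s\<^sub>k\<close>, where \<open>s\<^sub>k = sin (k \<pi> / n)\<close> is positive for \<open>0 < k < n\<close>;
  these are the weights for which the eigenvector gives equality. The three-term recurrence of the
  sine then makes the coefficients of each \<open>S\<^sub>k\<^sup>2\<close> add up to \<open>2 + 2 cos (\<pi> / n)\<close>.\<close>

lemma dirichlet_energy_upper_bound:
  fixes S :: "nat \<Rightarrow> real"
  assumes n: "n \<ge> 2" and S0: "S 0 = 0" and Sn: "S n = 0"
  shows "(\<Sum>k<n. (S (Suc k) - S k)\<^sup>2) \<le> 2 * (1 + cos (pi / n)) * (\<Sum>k<n. (S k)\<^sup>2)"
proof -
  define c where "c = cos (pi / n)"
  define s where "s = (\<lambda>k. sin (real k * (pi / n)))"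
  have s_pos: "s k > 0" if "0 < k" "k < n" for k
    unfolding s_def using that by (intro sin_gt_zero) (auto simp: field_simps)
  have rec: "s m + s (Suc (Suc m)) = 2 * c * s (Suc m)" for m
    unfolding s_def c_def by (rule sin_three_term)
  \<comment> \<open>The bound for an initial segment: the last square still has only part of its coefficient,
    the rest being needed for the next cross term.\<close>
  have partial: "(\<Sum>k<Suc m. (S (Suc k) - S k)\<^sup>2)
      \<le> 2 * (1 + c) * (\<Sum>k<Suc m. (S k)\<^sup>2) + (1 + s m / s (Suc m)) * (S (Suc m))\<^sup>2"
    if "Suc m < n" for m
    using that
  proof (induction m)
    case 0
    then show ?case by (simp add: S0 s_def)
  next
    case (Suc m)
    let ?x = "S (Suc m)" and ?y = "S (Suc (Suc m))"
    let ?r = "s (Suc (Suc m)) / s (Suc m)"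
    have pos: "s (Suc m) > 0" "s (Suc (Suc m)) > 0" using Suc.prems s_pos by auto
    have coeff: "2 * c - s m / s (Suc m) = ?r"
      using pos rec[of m] by (simp add: field_simps)
    have "(?y - ?x)\<^sup>2 \<le> ?y\<^sup>2 + ?x\<^sup>2 + (?r * ?x\<^sup>2 + ?y\<^sup>2 / ?r)"
      using minus_two_mult_le_weighted_squares[of ?r ?x ?y] pos
      by (simp add: power2_eq_square algebra_simps)
    also have "\<dots> = 2 * (1 + c) * ?x\<^sup>2 - (1 + s m / s (Suc m)) * ?x\<^sup>2
        + (1 + s (Suc m) / s (Suc (Suc m))) * ?y\<^sup>2"
      using arg_cong[OF coeff, of "\<lambda>q. q * ?x\<^sup>2"] by (simp add: algebra_simps)
    finally have "(?y - ?x)\<^sup>2 \<le> 2 * (1 + c) * ?x\<^sup>2 - (1 + s m / s (Suc m)) * ?x\<^sup>2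
        + (1 + s (Suc m) / s (Suc (Suc m))) * ?y\<^sup>2" .
    moreover have "(\<Sum>k<Suc m. (S (Suc k) - S k)\<^sup>2)
      \<le> 2 * (1 + c) * (\<Sum>k<Suc m. (S k)\<^sup>2) + (1 + s m / s (Suc m)) * (S (Suc m))\<^sup>2"
      using Suc by simp
    ultimately show ?case
      by (simp only: sum.lessThan_Suc[of _ "Suc m"] distrib_left)
  qed
  obtain m where m: "n = Suc (Suc m)" using n by (metis add_2_eq_Suc le_Suc_ex)
  have "s n = 0" using n by (simp add: s_def)
  then have "s m / s (Suc m) = 2 * c"
    using rec[of m] s_pos[of "Suc m"] by (simp add: m field_simps)
  with partial[of m] Sn have "(\<Sum>k<n. (S (Suc k) - S k)\<^sup>2) \<le> 2 * (1 + c) * (\<Sum>k<n. (S k)\<^sup>2)"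
    unfolding m by (simp add: algebra_simps)
  then show ?thesis unfolding c_def .
qed

text \<open>Equality holds for the alternating sine. The boundary term that remains in the summation by
  parts vanishes when \<open>(m + 1) t = \<pi>\<close>.\<close>

lemma dirichlet_energy_alternating_sine:
  fixes t :: real
  defines "S \<equiv> \<lambda>k. (-1) ^ k * sin (real k * t)"
  shows "(\<Sum>k<Suc m. (S (Suc k) - S k)\<^sup>2) = 2 * (1 + cos t) * (\<Sum>k<Suc m. (S k)\<^sup>2)
    + (sin (real m * t) + sin (real (Suc m) * t)) * sin (real (Suc m) * t)"
proof -
  have diff: "(S (Suc k) - S k)\<^sup>2 = (sin (real (Suc k) * t) + sin (real k * t))\<^sup>2" for k
    by (cases "even k") (simp_all add: S_def power2_eq_square algebra_simps)
  have square: "(S k)\<^sup>2 = (sin (real k * t))\<^sup>2" for k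
    by (cases "even k") (simp_all add: S_def)
  show ?thesis
    unfolding diff square
  proof (induction m)
    case 0
    then show ?case by (simp add: power2_eq_square)
  next
    case (Suc m)
    let ?a = "sin (real m * t)" and ?b = "sin (real (Suc m) * t)"
      and ?d = "sin (real (Suc (Suc m)) * t)"
    have "?a = 2 * cos t * ?b - ?d" using sin_three_term[of m t] by linarith
    then have "(?d + ?b)\<^sup>2 + (?a + ?b) * ?b = 2 * (1 + cos t) * ?b\<^sup>2 + (?b + ?d) * ?d"
      by (simp only:) (simp add: power2_eq_square algebra_simps)
    then show ?case
      using Suc by (simp only: sum.lessThan_Suc[of _ "Suc m"] distrib_left)
  qed
qed

section \<open>The quadratic embedding constant of a path\<close>

theorem QEC_path_graph:
  assumes n: "n \<ge> 2"
  shows "QEC (path_graph n) = - 1 / (1 + cos (pi / n))"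
proof -
  define t where "t = pi / n"
  have t: "0 < t" "t \<le> pi / 2" "real n * t = pi"
    using n by (auto simp: t_def field_simps)
  have c: "1 + cos t > 0" using cos_ge_zero[of t] t by simp
  let ?V = "verts (path_graph n)" and ?Q = "\<lambda>f. inner_on (verts (path_graph n)) f
    (dist_matrix_apply (path_graph n) f)"
  have mean: "inner_on ?V (\<lambda>_. 1) f = (\<Sum>i=1..n. f i)" for f
    by (simp add: inner_on_def path_graph_def)
  show ?thesis
    unfolding QEC_def t_def[symmetric]
  proof (rule Greatest_equality)
    define S where "S = (\<lambda>k. (-1) ^ k * sin (real k * t))"
    define A where "A = (\<Sum>k<n. (S k)\<^sup>2)"
    have Sn: "S n = 0" and S0: "S 0 = 0" by (simp_all add: S_def t)
    have "sin t > 0" using t pi_gt_zero by (intro sin_gt_zero) auto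
    then have "0 < (S 1)\<^sup>2" by (simp add: S_def)
    also have "(S 1)\<^sup>2 \<le> A"
      unfolding A_def using n by (intro member_le_sum) auto
    finally have A: "A > 0" .
    obtain m where m: "n = Suc m" using n by (metis Suc_le_D numeral_2_eq_2)
    have energy: "(\<Sum>k<n. (S (Suc k) - S k)\<^sup>2) = 2 * (1 + cos t) * A"
      using dirichlet_energy_alternating_sine[where m = m and t = t] t(3)
      unfolding A_def S_def m by simp
    \<comment> \<open>The maximiser: the increments of the alternating sine, scaled to unit norm.\<close>
    define N where "N = sqrt (2 * (1 + cos t) * A)"
    have N: "N\<^sup>2 = 2 * (1 + cos t) * A" "N > 0" using A c by (simp_all add: N_def)
    define f where "f = (\<lambda>i. (S i - S (i - 1)) / N)"
    have sums: "(\<Sum>i=1..k. f i) = S k / N" for k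
      by (induction k) (simp_all add: f_def S0 diff_divide_distrib)
    have "inner_on ?V f f = (\<Sum>k<n. (S (Suc k) - S k)\<^sup>2 / N\<^sup>2)"
      unfolding inner_on_path_graph_partial_sums sums
      by (simp add: diff_divide_distrib[symmetric] power_divide)
    also have "\<dots> = 1"
      unfolding sum_divide_distrib[symmetric] energy N(1)[symmetric] using N(2) by simp
    finally have norm: "inner_on ?V f f = 1" .
    have zero: "(\<Sum>i=1..n. f i) = 0" unfolding sums by (simp add: Sn)
    have "?Q f = - 2 * (A / N\<^sup>2)"
      unfolding path_graph_distance_form[OF zero] sums
      by (simp add: A_def power_divide sum_divide_distrib)
    also have "\<dots> = - 1 / (1 + cos t)"
    proof -
      have "- 2 * (A / (2 * d * A)) = - 1 / d" if "d > 0" for d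
        using that A by (simp add: field_simps)
      from this[OF c] show ?thesis unfolding N(1) .
    qed
    finally show "- 1 / (1 + cos t) \<in> {?Q f |f. inner_on ?V f f = 1 \<and> inner_on ?V (\<lambda>_. 1) f = 0}"
      using norm zero mean[of f] by (auto intro!: exI[of _ f])
  next
    fix y assume "y \<in> {?Q f |f. inner_on ?V f f = 1 \<and> inner_on ?V (\<lambda>_. 1) f = 0}"
    then obtain f where f: "y = ?Q f" "inner_on ?V f f = 1" "(\<Sum>i=1..n. f i) = 0"
      by (auto simp: mean)
    have "1 \<le> 2 * (1 + cos t) * (\<Sum>k<n. (\<Sum>i=1..k. f i)\<^sup>2)"
      using dirichlet_energy_upper_bound[of n "\<lambda>k. \<Sum>i=1..k. f i"] n f(2,3)
      unfolding inner_on_path_graph_partial_sums t_def by simp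
    moreover have "y = - 2 * (\<Sum>k<n. (\<Sum>i=1..k. f i)\<^sup>2)"
      unfolding f(1) by (rule path_graph_distance_form[OF f(3)])
    ultimately show "y \<le> - 1 / (1 + cos t)"
      using c by (simp add: field_simps)
  qed
qed

theorem theorem3p4:
  fixes n :: nat
  assumes "n \<ge> 2"
  shows "QEC (path_graph n) < QEC (path_graph (n + 1))"
proof -
  have "cos (pi / n) < cos (pi / (n + 1))"
    using assms by (intro cos_monotone_0_pi) (auto simp: field_simps)
  moreover have "cos (pi / n) \<ge> 0"
    using assms by (intro cos_ge_zero) (auto simp: field_simps intro: order_trans[of _ 0])
  ultimately show ?thesis
    using assms by (simp add: QEC_path_graph field_simps)
qed

end
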